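(* Let $M=(M^{AB})_{A,B=1}^4$ be a symmetric complex matrix, $Z_1,Z_2,Z_3,Z_4$ pairwise distinct complex numbers, $g, A_2,G_3\in\mathbb{C}$, and let $\chi_{1A},\chi_{4A}\in\mathbb{C}$ ($A=1,\dots,4$). Let $$f_1=\Psi_1^A\chi_{1A},\qquad f_2=A_2,\qquad f_3=\tfrac1{24}\epsilon_{ABCD}\Psi_3^A\Psi_3^B\Psi_3^C\Psi_3^D\,G_3,\qquad f_4=\Psi_4^A\chi_{4A}$$ be the external wavefunctions of particles of helicities $+\tfrac12,+1,-1,+\tfrac12$. Then the integral over the moduli of degree-one curves in the deformed super twistor space $$2ig^2\int\prod_{i=1}^4 d^4\Psi_i\int d^8\theta\ \prod_{i=1}^4\delta^4\!\Big(\Psi_i^A+\theta_1^A+\theta_2^AZ_i-\tfrac16M^{AB}\epsilon_{BCDE}\theta_2^C\theta_2^D\theta_2^EZ_i^2\Big)\frac{f_1f_2f_3f_4}{\prod_{i=1}^4\langle i,i+1\rangle}$$ equals $$2ig^2\,\frac{\langle3,1\rangle\langle3,4\rangle\langle4,1\rangle}{\prod_{i=1}^4\langle i,i+1\rangle}\ \chi_{4B}M^{BA}\chi_{1A}\,G_3A_2 .$$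
   Context: Repeated indices $A,B,\dots$ are summed over $1,\dots,4$; $\epsilon_{ABCD}$ is totally antisymmetric with $\epsilon_{1234}=1$. Spinors are scaled to $\lambda_i=(1,Z_i)$, so $\langle i,j\rangle=Z_j-Z_i$, and $\langle 4,5\rangle$ means $\langle4,1\rangle$. $\theta_1^A,\theta_2^A$ ($A=1,\dots,4$) are eight anticommuting Grassmann generators and $\Psi_i^A$ are further anticommuting variables. The fermionic delta functions are defined by $\int d^4\Psi\,\delta^4(\Psi^A-\Psi_0^A)f(\Psi)=f(\Psi_0)$, so the integrals over $\Psi_1,\dots,\Psi_4$ amount to substituting $\Psi_i^A=-\theta_1^A-\theta_2^AZ_i+\frac16M^{AB}\epsilon_{BCDE}\theta_2^C\theta_2^D\theta_2^EZ_i^2$ into the product $f_1f_2f_3f_4$ (taken in this order). The Berezin integral $\int d^8\theta$ picks out the coefficient of $\theta_1^1\theta_1^2\theta_1^3\theta_1^4\theta_2^1\theta_2^2\theta_2^3\theta_2^4$. *)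

theory Defs
  imports "HOL-Analysis.Analysis"
begin

section \<open>Complex Grassmann algebras on finitely many generators\<close>

text \<open>
  An element is stored by its coefficients: \<open>S\<close> stands for the product of the generators in \<open>S\<close>,
  taken in increasing order with respect to \<open>to_nat\<close>.  This auxiliary order is only used to fix the
  signs of the basis monomials; products, derivatives and integrals do not depend on it.
\<close>

typedef ('i::finite) grassmann = "UNIV :: ('i set \<Rightarrow> complex) set"
  morphisms gcoeff Abs_grassmann ..

setup_lifting type_definition_grassmann

lemma grassmann_eqI: "(\<And>S. gcoeff a S = gcoeff b S) \<Longrightarrow> a = b"
  by (metis ext gcoeff_inject)

text \<open>The sign needed to sort the concatenation of the monomials of \<open>S\<close> and \<open>T\<close>.\<close>

definition gsign :: "'i::finite set \<Rightarrow> 'i set \<Rightarrow> complex" where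
  "gsign S T = (- 1) ^ card {(s, t). s \<in> S \<and> t \<in> T \<and> to_nat t < to_nat s}"

lemma gsign_empty [simp]: "gsign {} T = 1" "gsign S {} = 1"
  by (simp_all add: gsign_def)

lemma gsign_Un_left: "S \<inter> T = {} \<Longrightarrow> gsign (S \<union> T) U = gsign S U * gsign T U"
proof -
  assume "S \<inter> T = {}"
  have "{(s, t). s \<in> S \<union> T \<and> t \<in> U \<and> to_nat t < to_nat s} =
    {(s, t). s \<in> S \<and> t \<in> U \<and> to_nat t < to_nat s} \<union> {(s, t). s \<in> T \<and> t \<in> U \<and> to_nat t < to_nat s}"
    by auto
  moreover have "{(s, t). s \<in> S \<and> t \<in> U \<and> to_nat t < to_nat s} \<inter>
      {(s, t). s \<in> T \<and> t \<in> U \<and> to_nat t < to_nat s} = {}"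
    using \<open>S \<inter> T = {}\<close> by auto
  ultimately show ?thesis
    by (simp add: gsign_def card_Un_disjoint power_add)
qed

lemma gsign_Un_right: "T \<inter> U = {} \<Longrightarrow> gsign S (T \<union> U) = gsign S T * gsign S U"
proof -
  assume "T \<inter> U = {}"
  have "{(s, t). s \<in> S \<and> t \<in> T \<union> U \<and> to_nat t < to_nat s} =
    {(s, t). s \<in> S \<and> t \<in> T \<and> to_nat t < to_nat s} \<union> {(s, t). s \<in> S \<and> t \<in> U \<and> to_nat t < to_nat s}"
    by auto
  moreover have "{(s, t). s \<in> S \<and> t \<in> T \<and> to_nat t < to_nat s} \<inter>
      {(s, t). s \<in> S \<and> t \<in> U \<and> to_nat t < to_nat s} = {}"
    using \<open>T \<inter> U = {}\<close> by auto
  ultimately show ?thesis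
    by (simp add: gsign_def card_Un_disjoint power_add)
qed

lemma gsign_singletons: "gsign {x} {y} = (if to_nat y < to_nat x then - 1 else 1)"
proof -
  have "{(s, t). s \<in> {x} \<and> t \<in> {y} \<and> to_nat t < to_nat s} =
    (if to_nat y < to_nat x then {(x, y)} else {})"
    by auto
  then show ?thesis
    by (simp add: gsign_def)
qed

lemma gsign_swap: "x \<noteq> y \<Longrightarrow> gsign {x} {y} = - gsign {y} {x}"
  by (auto simp: gsign_singletons)

lemma gsign_square: "gsign S T * gsign S T = 1"
  by (simp add: gsign_def flip: power_mult_distrib)

instantiation grassmann :: (finite) ring_1
begin

lift_definition zero_grassmann :: "'a grassmann" is "\<lambda>_. 0" .
lift_definition one_grassmann :: "'a grassmann" is "\<lambda>S. if S = {} then 1 else 0" .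
lift_definition plus_grassmann :: "'a grassmann \<Rightarrow> 'a grassmann \<Rightarrow> 'a grassmann"
  is "\<lambda>a b S. a S + b S" .
lift_definition minus_grassmann :: "'a grassmann \<Rightarrow> 'a grassmann \<Rightarrow> 'a grassmann"
  is "\<lambda>a b S. a S - b S" .
lift_definition uminus_grassmann :: "'a grassmann \<Rightarrow> 'a grassmann"
  is "\<lambda>a S. - a S" .
lift_definition times_grassmann :: "'a grassmann \<Rightarrow> 'a grassmann \<Rightarrow> 'a grassmann"
  is "\<lambda>a b S. \<Sum>T\<in>Pow S. gsign T (S - T) * a T * b (S - T)" .

instance
proof
  fix a b c :: "'a grassmann"
  show "a * b * c = a * (b * c)"
  proof (rule grassmann_eqI)
    fix S :: "'a set"
    let ?f = "\<lambda>T U V. gcoeff a T * gcoeff b U * gcoeff c V"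
    have "gcoeff (a * b * c) S = (\<Sum>W\<in>Pow S. \<Sum>T\<in>Pow W.
        gsign W (S - W) * gsign T (W - T) * ?f T (W - T) (S - W))"
      by (simp add: times_grassmann.rep_eq sum_distrib_left sum_distrib_right mult_ac)
    also have "\<dots> = (\<Sum>(W, T)\<in>(SIGMA W:Pow S. Pow W).
        gsign W (S - W) * gsign T (W - T) * ?f T (W - T) (S - W))"
      by (subst sum.Sigma) auto
    also have "\<dots> = (\<Sum>(T, U)\<in>(SIGMA T:Pow S. Pow (S - T)).
        gsign T (S - T) * gsign U (S - T - U) * ?f T U (S - T - U))"
    proof (rule sum.reindex_bij_witness
        [of _ "\<lambda>(T, U). (T \<union> U, T)" "\<lambda>(W, T). (T, W - T)"], goal_cases)
      case (5 p)
      then obtain W T where p: "p = (W, T)" "T \<subseteq> W" "W \<subseteq> S" by auto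
      have "S - T - (W - T) = S - W" "W = T \<union> (W - T)" "S - T = (W - T) \<union> (S - W)"
        using p by auto
      moreover have "gsign (T \<union> (W - T)) (S - W) = gsign T (S - W) * gsign (W - T) (S - W)"
        by (rule gsign_Un_left) auto
      moreover have "gsign T ((W - T) \<union> (S - W)) = gsign T (W - T) * gsign T (S - W)"
        by (rule gsign_Un_right) auto
      ultimately show ?case
        using p by simp
    qed auto
    also have "\<dots> = (\<Sum>T\<in>Pow S. \<Sum>U\<in>Pow (S - T).
        gsign T (S - T) * gsign U (S - T - U) * ?f T U (S - T - U))"
      by (subst sum.Sigma) auto
    also have "\<dots> = gcoeff (a * (b * c)) S"
      by (simp add: times_grassmann.rep_eq sum_distrib_left sum_distrib_right mult_ac)
    finally show "gcoeff (a * b * c) S = gcoeff (a * (b * c)) S" .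
  qed
  show "1 * a = a"
  proof (rule grassmann_eqI)
    fix S :: "'a set"
    have "gcoeff (1 * a) S = (\<Sum>T\<in>Pow S. if T = {} then gcoeff a S else 0)"
      unfolding times_grassmann.rep_eq one_grassmann.rep_eq by (rule sum.cong) auto
    then show "gcoeff (1 * a) S = gcoeff a S" by simp
  qed
  show "a * 1 = a"
  proof (rule grassmann_eqI)
    fix S :: "'a set"
    have "gcoeff (a * 1) S = (\<Sum>T\<in>Pow S. if T = S then gcoeff a S else 0)"
      unfolding times_grassmann.rep_eq one_grassmann.rep_eq by (rule sum.cong) auto
    then show "gcoeff (a * 1) S = gcoeff a S" by simp
  qed
  show "(0::'a grassmann) \<noteq> 1"
    by transfer (metis zero_neq_one)
qed (transfer; simp add: fun_eq_iff algebra_simps sum.distrib)+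

end

lift_definition gconst :: "complex \<Rightarrow> 'i::finite grassmann" is
  "\<lambda>c S. if S = {} then c else 0" .

lift_definition gvar :: "'i \<Rightarrow> 'i::finite grassmann" is
  "\<lambda>x S. if S = {x} then 1 else 0" .

text \<open>Left derivative with respect to a generator.\<close>

lift_definition left_deriv :: "'i \<Rightarrow> 'i::finite grassmann \<Rightarrow> 'i grassmann" is
  "\<lambda>x a S. if x \<in> S then 0 else gsign {x} S * a (insert x S)" .

text \<open>
  Berezin integral over the generators \<open>xs = [x1, \<dots>, xn]\<close>: it extracts the coefficient of the
  monomial \<open>x1 \<cdots> xn\<close> (written on the left), see \<open>berezin_monomial\<close> and \<open>berezin_eq_0\<close>.
\<close>

definition berezin :: "'i::finite list \<Rightarrow> 'i grassmann \<Rightarrow> 'i grassmann" where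
  "berezin xs a = fold left_deriv xs a"

lemma gcoeff_sum: "gcoeff (sum f I) S = (\<Sum>i\<in>I. gcoeff (f i) S)"
  by (induction I rule: infinite_finite_induct)
    (simp_all add: zero_grassmann.rep_eq plus_grassmann.rep_eq)

lemma gcoeff_gconst_mult: "gcoeff (gconst c * a) S = c * gcoeff a S"
proof -
  have "gcoeff (gconst c * a) S = (\<Sum>T\<in>Pow S. if T = {} then c * gcoeff a S else 0)"
    unfolding times_grassmann.rep_eq gconst.rep_eq by (rule sum.cong) auto
  then show ?thesis by simp
qed

lemma gcoeff_mult_gconst: "gcoeff (a * gconst c) S = c * gcoeff a S"
proof -
  have "gcoeff (a * gconst c) S = (\<Sum>T\<in>Pow S. if T = S then c * gcoeff a S else 0)"
    unfolding times_grassmann.rep_eq gconst.rep_eq by (rule sum.cong) auto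
  then show ?thesis by simp
qed

lemma gcoeff_gvar_mult:
  "gcoeff (gvar x * a) S = (if x \<in> S then gsign {x} (S - {x}) * gcoeff a (S - {x}) else 0)"
proof -
  have "gcoeff (gvar x * a) S =
      (\<Sum>T\<in>Pow S. if T = {x} then gsign {x} (S - {x}) * gcoeff a (S - {x}) else 0)"
    unfolding times_grassmann.rep_eq gvar.rep_eq by (rule sum.cong) auto
  then show ?thesis by simp
qed

lemma gconst_0 [simp]: "gconst 0 = 0" and gconst_1 [simp]: "gconst 1 = 1"
  by (transfer; auto)+

lemma gconst_add: "gconst (c + d) = gconst c + gconst d"
  and gconst_diff: "gconst (c - d) = gconst c - gconst d"
  and gconst_minus: "gconst (- c) = - gconst c"
  by (transfer; auto)+

lemma gconst_mult: "gconst (c * d) = gconst c * gconst d"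
  by (rule grassmann_eqI) (simp add: gcoeff_gconst_mult gconst.rep_eq)

lemma gconst_commute: "a * gconst c = gconst c * a"
  by (rule grassmann_eqI) (simp add: gcoeff_gconst_mult gcoeff_mult_gconst)

lemma gvar_square: "gvar x * gvar x = 0"
  by (rule grassmann_eqI) (auto simp: gcoeff_gvar_mult gvar.rep_eq zero_grassmann.rep_eq)

lemma gvar_anticommute: "gvar x * gvar y = - (gvar y * gvar x)"
proof (cases "x = y")
  case False
  then have "S - {x} = {y} \<and> x \<in> S \<longleftrightarrow> S = {x, y}" "S - {y} = {x} \<and> y \<in> S \<longleftrightarrow> S = {x, y}" for S
    by auto
  with False show ?thesis
    by (intro grassmann_eqI)
      (auto simp: gcoeff_gvar_mult gvar.rep_eq uminus_grassmann.rep_eq gsign_swap[of x y])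
qed (simp add: gvar_square)

lemma left_deriv_0 [simp]: "left_deriv x 0 = 0"
  and left_deriv_add: "left_deriv x (a + b) = left_deriv x a + left_deriv x b"
  and left_deriv_diff: "left_deriv x (a - b) = left_deriv x a - left_deriv x b"
  and left_deriv_minus: "left_deriv x (- a) = - left_deriv x a"
  by (transfer; auto simp: fun_eq_iff algebra_simps)+

lemma left_deriv_gconst [simp]: "left_deriv x (gconst c) = 0"
  by transfer auto

lemma left_deriv_gconst_mult: "left_deriv x (gconst c * a) = gconst c * left_deriv x a"
  by (rule grassmann_eqI) (simp add: gcoeff_gconst_mult left_deriv.rep_eq)

lemma left_deriv_gvar: "left_deriv x (gvar y) = (if x = y then 1 else 0)"
  by (rule grassmann_eqI)
    (auto simp: left_deriv.rep_eq gvar.rep_eq one_grassmann.rep_eq zero_grassmann.rep_eq)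

lemma left_deriv_gvar_mult:
  "left_deriv x (gvar y * a) = (if x = y then a else 0) - gvar y * left_deriv x a"
proof (rule grassmann_eqI)
  fix S
  have sq: "gsign {y} T * (gsign {y} T * c) = c" for T c
    by (metis gsign_square mult.assoc mult_1)
  consider "x = y" | "x \<noteq> y" "y \<notin> S" | "x \<noteq> y" "y \<in> S" "x \<in> S" | "x \<noteq> y" "y \<in> S" "x \<notin> S"
    by blast
  then show "gcoeff (left_deriv x (gvar y * a)) S =
      gcoeff ((if x = y then a else 0) - gvar y * left_deriv x a) S"
  proof cases
    case 4
    define U where "U = S - {y}"
    have S: "S = {y} \<union> U" "insert x S - {y} = {x} \<union> U" "y \<notin> U" "x \<notin> U"
      using 4 by (auto simp: U_def)
    have 1: "gsign {x} S = gsign {x} {y} * gsign {x} U"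
      unfolding S(1) using S by (intro gsign_Un_right) auto
    have 2: "gsign {y} ({x} \<union> U) = gsign {y} {x} * gsign {y} U"
      using S by (intro gsign_Un_right) auto
    have 3: "gsign {x} {y} * gsign {y} {x} = - 1"
      using gsign_swap[OF 4(1)] gsign_square[of "{y}" "{x}"] by simp
    have "gsign {x} S * gsign {y} ({x} \<union> U) =
        (gsign {x} {y} * gsign {y} {x}) * (gsign {y} U * gsign {x} U)"
      by (simp only: 1 2 mult_ac)
    also have "\<dots> = - (gsign {y} U * gsign {x} U)"
      by (simp add: 3)
    finally have key: "gsign {x} S * gsign {y} ({x} \<union> U) = - (gsign {y} U * gsign {x} U)" .
    have "gcoeff (left_deriv x (gvar y * a)) S =
        gsign {x} S * gsign {y} ({x} \<union> U) * gcoeff a ({x} \<union> U)"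
      using 4 by (simp only: left_deriv.rep_eq gcoeff_gvar_mult S(2)) simp
    also have "\<dots> = - (gsign {y} U * (gsign {x} U * gcoeff a ({x} \<union> U)))"
      by (simp only: key) simp
    also have "\<dots> = gcoeff ((if x = y then a else 0) - gvar y * left_deriv x a) S"
      using 4 S(4) by (simp add: left_deriv.rep_eq gcoeff_gvar_mult uminus_grassmann.rep_eq
          flip: U_def)
    finally show ?thesis .
  next
    case 1
    then show ?thesis
      by (cases "x \<in> S") (simp_all add: gcoeff_gvar_mult left_deriv.rep_eq
          minus_grassmann.rep_eq sq insert_absorb)
  next
    case 2
    then show ?thesis
      by (simp add: gcoeff_gvar_mult left_deriv.rep_eq uminus_grassmann.rep_eq)
  next
    case 3
    then show ?thesis
      by (simp add: gcoeff_gvar_mult left_deriv.rep_eq uminus_grassmann.rep_eq)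
  qed
qed

lemma left_deriv_anticommute: "left_deriv x (left_deriv y a) = - left_deriv y (left_deriv x a)"
proof (rule grassmann_eqI)
  fix S
  consider "x = y" | "x \<in> S \<or> y \<in> S" | "x \<noteq> y" "y \<notin> S" "x \<notin> S"
    by blast
  then show "gcoeff (left_deriv x (left_deriv y a)) S = gcoeff (- left_deriv y (left_deriv x a)) S"
  proof cases
    case 3
    have "gsign {x} ({y} \<union> S) = gsign {x} {y} * gsign {x} S"
      "gsign {y} ({x} \<union> S) = gsign {y} {x} * gsign {y} S"
      using 3 by (intro gsign_Un_right; auto)+
    then show ?thesis
      using 3 gsign_swap[of x y]
      by (simp add: left_deriv.rep_eq uminus_grassmann.rep_eq insert_commute[of x y])
  qed (auto simp: left_deriv.rep_eq uminus_grassmann.rep_eq)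
qed

lemma berezin_Nil [simp]: "berezin [] a = a"
  and berezin_Cons: "berezin (x # xs) a = berezin xs (left_deriv x a)"
  by (simp_all add: berezin_def)

lemma berezin_0 [simp]: "berezin xs 0 = 0"
  by (induction xs) (simp_all add: berezin_Cons)

lemma berezin_add: "berezin xs (a + b) = berezin xs a + berezin xs b"
  by (induction xs arbitrary: a b) (simp_all add: berezin_Cons left_deriv_add)

lemma berezin_gconst_mult: "berezin xs (gconst c * a) = gconst c * berezin xs a"
  by (induction xs arbitrary: a) (simp_all add: berezin_Cons left_deriv_gconst_mult)

lemma berezin_eq_0: "x \<in> set xs \<Longrightarrow> left_deriv x a = 0 \<Longrightarrow> berezin xs a = 0"
proof (induction xs arbitrary: a)
  case (Cons y xs)
  show ?case
  proof (cases "x = y")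
    case False
    have "left_deriv x (left_deriv y a) = 0"
      using Cons.prems left_deriv_anticommute[of x y a] by simp
    then show ?thesis
      using Cons False by (simp add: berezin_Cons)
  qed (use Cons in \<open>simp add: berezin_Cons\<close>)
qed simp

lemma left_deriv_prod_gvar_eq_0:
  "x \<notin> set xs \<Longrightarrow> left_deriv x a = 0 \<Longrightarrow> left_deriv x (prod_list (map gvar xs) * a) = 0"
  by (induction xs) (auto simp: mult.assoc left_deriv_gvar_mult)

lemma berezin_monomial:
  assumes "distinct xs" and "\<And>x. x \<in> set xs \<Longrightarrow> left_deriv x a = 0"
  shows "berezin xs (prod_list (map gvar xs) * a) = a"
  using assms
  by (induction xs) (auto simp: berezin_Cons mult.assoc left_deriv_gvar_mult left_deriv_prod_gvar_eq_0)

text \<open>Homogeneous elements; the flag says whether the element is even.\<close>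

inductive gparity :: "bool \<Rightarrow> 'i::finite grassmann \<Rightarrow> bool" where
  gparity_gconst: "gparity True (gconst c)"
| gparity_gvar: "gparity False (gvar x)"
| gparity_add: "gparity p a \<Longrightarrow> gparity p b \<Longrightarrow> gparity p (a + b)"
| gparity_mult: "gparity p a \<Longrightarrow> gparity q b \<Longrightarrow> gparity (p = q) (a * b)"

lemma gparity_gconst_mult: "gparity p a \<Longrightarrow> gparity p (gconst c * a)"
  using gparity_mult[OF gparity_gconst, of p a c] by simp

lemma gparity_minus: "gparity p a \<Longrightarrow> gparity p (- a)"
  using gparity_gconst_mult[of p a "- 1"] by (simp add: gconst_minus)

lemma gparity_diff: "gparity p a \<Longrightarrow> gparity p b \<Longrightarrow> gparity p (a - b)"
  using gparity_add[OF _ gparity_minus, of p a b] by simp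

lemma left_deriv_mult_gparity:
  "gparity p a \<Longrightarrow> left_deriv x (a * b) = left_deriv x a * b + (if p then a else - a) * left_deriv x b"
  by (induction arbitrary: b rule: gparity.induct)
    (auto simp: left_deriv_gconst_mult left_deriv_gvar left_deriv_gvar_mult left_deriv_add algebra_simps)

lemma gparity_commute_gvar:
  "gparity p a \<Longrightarrow> gvar x * a = (if p then a else - a) * gvar x"
proof (induction rule: gparity.induct)
  case (gparity_mult p a q b)
  have "gvar x * (a * b) = (if p then a else - a) * (gvar x * b)"
    by (simp only: gparity_mult.IH(1) flip: mult.assoc)
  also have "\<dots> = (if p then a else - a) * ((if q then b else - b) * gvar x)"
    by (simp only: gparity_mult.IH(2))
  finally show ?case
    by (auto simp: mult.assoc)
qed (auto simp: gconst_commute distrib_left distrib_right left_diff_distrib gvar_anticommute[of x])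

lemma gparity_commute:
  "gparity p a \<Longrightarrow> gparity q b \<Longrightarrow> a * b = (if p \<or> q then b * a else - (b * a))"
proof (induction arbitrary: q b rule: gparity.induct)
  case (gparity_gconst c)
  then show ?case by (simp add: gconst_commute)
next
  case (gparity_gvar x)
  then show ?case using gparity_commute_gvar[of q b x] by auto
next
  case (gparity_add p a c)
  then show ?case
    by (simp only: distrib_right gparity_add.IH[OF gparity_add.prems]) (simp add: distrib_left)
next
  case (gparity_mult p a r c)
  have "a * c * b = a * (if r \<or> q then b * c else - (b * c))"
    by (simp only: gparity_mult.IH(2)[OF gparity_mult.prems] mult.assoc)
  also have "\<dots> = (if r \<or> q then a * b * c else - (a * b * c))"
    by (simp add: mult.assoc)
  also have "a * b * c = (if p \<or> q then b * a else - (b * a)) * c"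
    by (simp only: gparity_mult.IH(1)[OF gparity_mult.prems])
  finally have *: "a * c * b = (if r \<or> q then (if p \<or> q then b * a else - (b * a)) * c
      else - ((if p \<or> q then b * a else - (b * a)) * c))" .
  show ?case
    unfolding * by (auto simp: mult.assoc)
qed

lemma grassmann_add_self_eq_0: "a + a = 0 \<Longrightarrow> a = 0" for a :: "'i::finite grassmann"
  by transfer (simp add: fun_eq_iff)

lemma gparity_odd_square:
  assumes "gparity False a"
  shows "a * a = 0"
proof (rule grassmann_add_self_eq_0)
  have "a * a = - (a * a)"
    using gparity_commute[OF assms assms] by (simp only: simp_thms if_False)
  then show "a * a + a * a = 0"
    by (simp only: eq_neg_iff_add_eq_0)
qed


section \<open>Variables of the super twistor integral\<close>

text \<open>
  All labels (\<open>A\<close> and particle labels) live in the type \<open>4\<close>, i.e. the integers modulo 4 with elements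
  \<open>1, 2, 3, 4 = 0\<close>; in particular \<open>4 + 1 = 1\<close>, as wanted for the cyclic products.  The generators are
  \<open>\<theta>\<^sub>1\<^sup>A\<close>, \<open>\<theta>\<^sub>2\<^sup>A\<close> and \<open>\<Psi>\<^sub>i\<^sup>A\<close>.
\<close>

datatype gen = Th1 4 | Th2 4 | Ps 4 4

instance gen :: finite
proof
  have "x \<in> range Th1 \<union> range Th2 \<union> range (\<lambda>(i, A). Ps i A)" for x
    by (cases x) auto
  then have "(UNIV :: gen set) = range Th1 \<union> range Th2 \<union> range (\<lambda>(i, A). Ps i A)"
    by blast
  then show "finite (UNIV :: gen set)"
    by (rule ssubst) simp
qed

abbreviation \<theta>\<^sub>1 :: "4 \<Rightarrow> gen grassmann" where "\<theta>\<^sub>1 A \<equiv> gvar (Th1 A)"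
abbreviation \<theta>\<^sub>2 :: "4 \<Rightarrow> gen grassmann" where "\<theta>\<^sub>2 A \<equiv> gvar (Th2 A)"
abbreviation \<Psi> :: "4 \<Rightarrow> 4 \<Rightarrow> gen grassmann" where "\<Psi> i A \<equiv> gvar (Ps i A)"

definition int_\<theta> :: "gen grassmann \<Rightarrow> gen grassmann" where
  "int_\<theta> = berezin [Th1 1, Th1 2, Th1 3, Th1 4, Th2 1, Th2 2, Th2 3, Th2 4]"

definition int_\<Psi> :: "4 \<Rightarrow> gen grassmann \<Rightarrow> gen grassmann" where
  "int_\<Psi> i = berezin [Ps i 1, Ps i 2, Ps i 3, Ps i 4]"

text \<open>
  The fermionic delta function.  That it satisfies
  \<open>\<integral>d\<^sup>4\<Psi> \<delta>\<^sup>4(\<Psi> - \<Psi>\<^sub>0) f(\<Psi>) = f(\<Psi>\<^sub>0)\<close> for odd \<open>\<Psi>\<^sub>0\<close> not involving \<open>\<Psi>\<close> is the content of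
  \<open>int_\<Psi>_delta_const\<close> and \<open>int_\<Psi>_delta_mult\<close>, together with additivity (\<open>berezin_add\<close>).
\<close>

definition fdelta :: "(4 \<Rightarrow> gen grassmann) \<Rightarrow> gen grassmann" where
  "fdelta \<eta> = \<eta> 1 * \<eta> 2 * \<eta> 3 * \<eta> 4"

definition levi_civita :: "4 \<Rightarrow> 4 \<Rightarrow> 4 \<Rightarrow> 4 \<Rightarrow> complex" where
  "levi_civita A B C D =
    (let p = (\<lambda>i::4. if i = 1 then A else if i = 2 then B else if i = 3 then C else D)
     in if bij p then of_int (sign p) else 0)"

text \<open>\<open>\<langle>i, j\<rangle>\<close> for the spinors \<open>\<lambda>\<^sub>i = (1, Z\<^sub>i)\<close>.\<close>

definition bracket :: "complex ^ 4 \<Rightarrow> 4 \<Rightarrow> 4 \<Rightarrow> complex" where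
  "bracket Z i j = Z $ j - Z $ i"

definition curve_arg :: "complex ^ 4 ^ 4 \<Rightarrow> complex ^ 4 \<Rightarrow> 4 \<Rightarrow> 4 \<Rightarrow> gen grassmann" where
  "curve_arg M Z i A = \<Psi> i A + \<theta>\<^sub>1 A + \<theta>\<^sub>2 A * gconst (Z $ i)
     - gconst (1 / 6) * (\<Sum>B\<in>UNIV. \<Sum>C\<in>UNIV. \<Sum>D\<in>UNIV. \<Sum>E\<in>UNIV.
         gconst (M $ A $ B * levi_civita B C D E) * \<theta>\<^sub>2 C * \<theta>\<^sub>2 D * \<theta>\<^sub>2 E) * gconst ((Z $ i)\<^sup>2)"

text \<open>External wavefunctions of helicity \<open>+1/2\<close>, \<open>+1\<close> and \<open>-1\<close>.\<close>

definition wf_plus_half :: "4 \<Rightarrow> complex ^ 4 \<Rightarrow> gen grassmann" where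
  "wf_plus_half i c = (\<Sum>A\<in>UNIV. \<Psi> i A * gconst (c $ A))"

definition wf_plus_one :: "complex \<Rightarrow> gen grassmann" where
  "wf_plus_one a = gconst a"

definition wf_minus_one :: "4 \<Rightarrow> complex \<Rightarrow> gen grassmann" where
  "wf_minus_one i G = gconst (1 / 24) * (\<Sum>A\<in>UNIV. \<Sum>B\<in>UNIV. \<Sum>C\<in>UNIV. \<Sum>D\<in>UNIV.
     gconst (levi_civita A B C D) * \<Psi> i A * \<Psi> i B * \<Psi> i C * \<Psi> i D) * gconst G"


subsection \<open>Consistency of the conventions\<close>

lemma levi_civita_1234: "levi_civita 1 2 3 4 = 1"
proof -
  have "(\<lambda>i::4. if i = 1 then 1 else if i = 2 then 2 else if i = 3 then 3 else 4) = id"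
    using exhaust_4 by (auto simp: fun_eq_iff)
  then show ?thesis
    by (simp add: levi_civita_def Let_def sign_id)
qed

lemma levi_civita_swap:
  "levi_civita B A C D = - levi_civita A B C D" (is ?swap12)
  "levi_civita A C B D = - levi_civita A B C D" (is ?swap23)
  "levi_civita A B D C = - levi_civita A B C D" (is ?swap34)
proof -
  define p :: "4 \<Rightarrow> 4 \<Rightarrow> 4 \<Rightarrow> 4 \<Rightarrow> 4 \<Rightarrow> 4" where
    "p A B C D = (\<lambda>i. if i = 1 then A else if i = 2 then B else if i = 3 then C else D)" for A B C D
  have lc: "levi_civita A B C D = (if bij (p A B C D) then of_int (sign (p A B C D)) else 0)"
    for A B C D
    by (simp add: levi_civita_def p_def Let_def)
  have swap: "(if bij (f \<circ> Transposition.transpose i j) then of_int (sign (f \<circ> Transposition.transpose i j)) else 0) =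
      - (if bij f then of_int (sign f) else (0::complex))" if "i \<noteq> j" for f :: "4 \<Rightarrow> 4" and i j
  proof -
    have bij: "bij (f \<circ> Transposition.transpose i j) \<longleftrightarrow> bij f"
      using bij_betw_comp_iff[of "Transposition.transpose i j" UNIV UNIV f UNIV] by simp
    have "sign (f \<circ> Transposition.transpose i j) = - sign f" if "bij f"
    proof -
      have "permutation f" "permutation (Transposition.transpose i j)"
        using that by (auto simp: permutation finite_subset[OF subset_UNIV] permutation_swap_id)
      then show ?thesis
        using \<open>i \<noteq> j\<close> by (simp add: sign_compose sign_swap_id)
    qed
    with bij show ?thesis by auto
  qed
  have p: "p B A C D = p A B C D \<circ> Transposition.transpose 1 2" "p A C B D = p A B C D \<circ> Transposition.transpose 2 3"
    "p A B D C = p A B C D \<circ> Transposition.transpose 3 4"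
    by (auto simp: fun_eq_iff p_def Transposition.transpose_def) (metis exhaust_4)
  show ?swap12
    unfolding lc p(1) by (rule swap) simp
  show ?swap23
    unfolding lc p(2) by (rule swap) simp
  show ?swap34
    unfolding lc p(3) by (rule swap) simp
qed

lemma int_\<Psi>_delta_const:
  assumes "\<And>A. gparity False (\<eta> A)"
    and "\<And>A B. left_deriv (Ps i A) (\<eta> B) = 0" and "\<And>A. left_deriv (Ps i A) f = 0"
  shows "int_\<Psi> i (fdelta (\<lambda>A. \<Psi> i A - \<eta> A) * f) = f"
proof -
  have "left_deriv (Ps i A) ((\<Psi> i B - \<eta> B) * a) = (if A = B then a else 0)"
    if "left_deriv (Ps i A) a = 0" for A B a
    using that assms(2)
    by (simp add: left_deriv_mult_gparity[of False] gparity_diff gparity_gvar assms(1) left_deriv_diff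
        left_deriv_gvar)
  then show ?thesis
    by (simp add: int_\<Psi>_def fdelta_def berezin_Cons mult.assoc assms(3))
qed

lemma int_\<Psi>_delta_mult:
  assumes "\<And>A. gparity False (\<eta> A)"
    and "\<And>A B. left_deriv (Ps i A) (\<eta> B) = 0"
  shows "int_\<Psi> i (fdelta (\<lambda>A. \<Psi> i A - \<eta> A) * (\<Psi> i A * f)) =
    \<eta> A * int_\<Psi> i (fdelta (\<lambda>A. \<Psi> i A - \<eta> A) * f)"
proof -
  define \<xi> where "\<xi> A = \<Psi> i A - \<eta> A" for A
  let ?\<delta> = "fdelta \<xi>"
  have odd: "gparity False (\<xi> A)" for A
    by (simp add: \<xi>_def gparity_diff gparity_gvar assms(1))
  have comm: "\<xi> A * \<xi> B = - (\<xi> B * \<xi> A)" for A B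
    using gparity_commute[OF odd[of A] odd[of B]] by (simp only: simp_thms if_False)
  have comm': "\<xi> A * (\<xi> B * a) = - (\<xi> B * (\<xi> A * a))" for A B a
    using arg_cong[OF comm[of A B], of "\<lambda>c. c * a"] by (simp only: mult.assoc mult_minus_left)
  have sq: "\<xi> A * (\<xi> A * a) = 0" for A a
    using gparity_odd_square[OF odd] by (simp flip: mult.assoc)
  have "?\<delta> * (\<xi> A * f) = 0"
    using exhaust_4[of A]
    by (auto simp: fdelta_def mult.assoc sq comm'[of 4 3] comm'[of 4 2] comm'[of 4 1]
        comm'[of 3 2] comm'[of 3 1] comm'[of 2 1])
  then have "?\<delta> * (\<Psi> i A * f) = ?\<delta> * \<eta> A * f"
    by (simp add: \<xi>_def algebra_simps)
  also have "gparity True ?\<delta>"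
    using gparity_mult[OF gparity_mult[OF gparity_mult[OF odd[of 1] odd[of 2]] odd[of 3]] odd[of 4]]
    by (simp add: fdelta_def)
  then have "?\<delta> * \<eta> A = \<eta> A * ?\<delta>"
    using gparity_commute[of True ?\<delta> False "\<eta> A"] assms(1) by (simp only: simp_thms if_True)
  finally have "?\<delta> * (\<Psi> i A * f) = \<eta> A * (?\<delta> * f)"
    by (simp add: mult.assoc)
  moreover have "int_\<Psi> i (\<eta> A * a) = \<eta> A * int_\<Psi> i a" for a
    by (simp add: int_\<Psi>_def berezin_Cons left_deriv_mult_gparity[OF assms(1)] assms(2) left_deriv_minus)
  ultimately show ?thesis
    by (simp add: \<xi>_def[abs_def])
qed

end

theory Submission
  imports Defs
begin

text \<open>
  The \<open>\<Psi>\<close>-integrals substitute for \<open>\<Psi>\<^sub>i\<^sup>A\<close> the point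
  \<open>P\<^sub>i\<^sup>A = - \<theta>\<^sub>1\<^sup>A - Z\<^sub>i \<theta>\<^sub>2\<^sup>A + Z\<^sub>i\<^sup>2 m\<^sup>A\<close>, where \<open>m\<^sup>A = 1/6 M\<^sup>A\<^sup>B \<epsilon>\<^sub>B\<^sub>C\<^sub>D\<^sub>E \<theta>\<^sub>2\<^sup>C \<theta>\<^sub>2\<^sup>D \<theta>\<^sub>2\<^sup>E\<close>.
  The wavefunction of particle 3 becomes the product \<open>P\<^sub>3\<^sup>1 P\<^sub>3\<^sup>2 P\<^sub>3\<^sup>3 P\<^sub>3\<^sup>4\<close>, which is a delta function
  for \<open>\<theta>\<^sub>1\<close>; it annihilates every \<open>P\<^sub>3\<^sup>A\<close>, so \<open>P\<^sub>1\<close> and \<open>P\<^sub>4\<close> may be replaced by their differences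
  to \<open>P\<^sub>3\<close>, which contain \<open>\<theta>\<^sub>2\<close> only.  In the product of these two differences, the terms of degree
  four are those pairing \<open>\<theta>\<^sub>2\<^sup>A\<close> with \<open>m\<^sup>B\<close>, and \<open>\<theta>\<^sub>2\<^sup>A m\<^sup>B = M\<^sup>B\<^sup>A \<theta>\<^sub>2\<^sup>1 \<theta>\<^sub>2\<^sup>2 \<theta>\<^sub>2\<^sup>3 \<theta>\<^sub>2\<^sup>4\<close>.  Their coefficients
  combine to \<open>(Z\<^sub>1 - Z\<^sub>3) (Z\<^sub>4 - Z\<^sub>3) (Z\<^sub>1 - Z\<^sub>4)\<close>.
\<close>

section \<open>Evaluation and contraction of the Levi-Civita symbol\<close>

lemma levi_civita_repeat:
  "levi_civita A A C D = 0" "levi_civita A C C D = 0" "levi_civita A B C C = 0"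
  using levi_civita_swap(1)[of A A C D] levi_civita_swap(2)[of A C C D] levi_civita_swap(3)[of A B C C]
  by simp_all

text \<open>Only swaps of a descending neighbouring pair are listed, so rewriting is a terminating
  bubble sort of the labels, with the sign collected on the way.\<close>

lemmas levi_civita_sort =
  levi_civita_swap(1)[of 4 3] levi_civita_swap(1)[of 4 2] levi_civita_swap(1)[of 4 1]
  levi_civita_swap(1)[of 3 2] levi_civita_swap(1)[of 3 1] levi_civita_swap(1)[of 2 1]
  levi_civita_swap(2)[of _ 4 3] levi_civita_swap(2)[of _ 4 2] levi_civita_swap(2)[of _ 4 1]
  levi_civita_swap(2)[of _ 3 2] levi_civita_swap(2)[of _ 3 1] levi_civita_swap(2)[of _ 2 1]
  levi_civita_swap(3)[of _ _ 4 3] levi_civita_swap(3)[of _ _ 4 2] levi_civita_swap(3)[of _ _ 4 1]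
  levi_civita_swap(3)[of _ _ 3 2] levi_civita_swap(3)[of _ _ 3 1] levi_civita_swap(3)[of _ _ 2 1]

lemmas levi_civita_eval = levi_civita_sort levi_civita_repeat levi_civita_1234

lemma levi_civita_contract_3:
  \<comment> \<open>Two permutations that agree in three places agree in the fourth. For equal
    labels, each of the 3! orderings of the other three contributes the square of a sign.\<close>
  "(\<Sum>C\<in>UNIV. \<Sum>D\<in>UNIV. \<Sum>E\<in>UNIV. levi_civita B C D E * levi_civita A C D E) = (if A = B then 6 else 0)"
proof -
  \<comment> \<open>Both labels are quantified so that \<open>forall_4\<close> splits the claim into
    cases with concrete labels; the same device is used for the products below.\<close>
  have "\<forall>A B. (\<Sum>C\<in>UNIV. \<Sum>D\<in>UNIV. \<Sum>E\<in>UNIV. levi_civita B C D E * levi_civita A C D E) = (if A = B then 6 else 0)"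
    unfolding forall_4 by (simp add: sum_4 levi_civita_eval)
  then show ?thesis by blast
qed

section \<open>Products of four odd elements and their cubic duals\<close>

lemma odd_anticommute:
  "gparity False a \<Longrightarrow> gparity False b \<Longrightarrow> a * b = - (b * a)"
  using gparity_commute[of False a False b] by (simp only: simp_thms if_False)

lemma odd_left_anticommute:
  assumes "gparity False a" "gparity False b"
  shows "a * (b * c) = - (b * (a * c))"
proof -
  have "a * b * c = - (b * a) * c"
    by (simp only: odd_anticommute[OF assms])
  then show ?thesis
    by (simp add: mult.assoc)
qed

context
  fixes \<eta> :: "4 \<Rightarrow> gen grassmann"
  assumes odd: "\<And>A. gparity False (\<eta> A)"
begin

text \<open>The analogue of \<open>levi_civita_sort\<close> for products. Each swap also appears
  with a trailing factor, because the products are nested to the right.\<close>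

private lemmas reorder =
  odd_anticommute[OF odd[of 4] odd[of 3]] odd_left_anticommute[OF odd[of 4] odd[of 3]]
  odd_anticommute[OF odd[of 4] odd[of 2]] odd_left_anticommute[OF odd[of 4] odd[of 2]]
  odd_anticommute[OF odd[of 4] odd[of 1]] odd_left_anticommute[OF odd[of 4] odd[of 1]]
  odd_anticommute[OF odd[of 3] odd[of 2]] odd_left_anticommute[OF odd[of 3] odd[of 2]]
  odd_anticommute[OF odd[of 3] odd[of 1]] odd_left_anticommute[OF odd[of 3] odd[of 1]]
  odd_anticommute[OF odd[of 2] odd[of 1]] odd_left_anticommute[OF odd[of 2] odd[of 1]]

private lemma square: "\<eta> A * \<eta> A = 0" "\<eta> A * (\<eta> A * a) = 0"
  using gparity_odd_square[OF odd[of A]] by (simp_all flip: mult.assoc)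

text \<open>Both sides change sign under neighbouring swaps, vanish on a repeated label and agree
  for 1, 2, 3, 4.\<close>

lemma odd_product_4: "\<eta> A * (\<eta> B * (\<eta> C * \<eta> D)) = gconst (levi_civita A B C D) * fdelta \<eta>"
proof -
  have "\<forall>A B C D. \<eta> A * (\<eta> B * (\<eta> C * \<eta> D)) = gconst (levi_civita A B C D) * fdelta \<eta>"
    unfolding forall_4
    by (simp add: levi_civita_eval gconst_minus fdelta_def mult.assoc square reorder)
  then show ?thesis by blast
qed

text \<open>A fifth factor repeats one of the four labels, and odd elements square to zero.\<close>

lemma odd_mult_fdelta: "\<eta> A * fdelta \<eta> = 0" "fdelta \<eta> * \<eta> A = 0"
proof -
  have "\<forall>A. \<eta> A * fdelta \<eta> = 0 \<and> fdelta \<eta> * \<eta> A = 0"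
    unfolding forall_4 by (simp add: fdelta_def mult.assoc square reorder)
  then show "\<eta> A * fdelta \<eta> = 0" "fdelta \<eta> * \<eta> A = 0" by blast+
qed

end

lemma gconst_sum: "gconst (sum f I) = (\<Sum>i\<in>I. gconst (f i))"
  by (induction I rule: infinite_finite_induct) (simp_all add: gconst_add)

lemma left_deriv_1 [simp]: "left_deriv x 1 = 0"
  using left_deriv_gconst[of x 1] by simp

lemma gconst_left_commute: "a * (gconst c * b) = gconst c * (a * b)"
  by (metis gconst_commute mult.assoc)

text \<open>For odd \<open>\<eta>\<close> this is six times the formal left derivative of
  \<open>fdelta \<eta>\<close> with respect to \<open>\<eta> B\<close>: up to sign, the product of
  the three other elements.\<close>

definition cubic :: "(4 \<Rightarrow> gen grassmann) \<Rightarrow> 4 \<Rightarrow> gen grassmann" where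
  "cubic \<eta> B = (\<Sum>C\<in>UNIV. \<Sum>D\<in>UNIV. \<Sum>E\<in>UNIV. gconst (levi_civita B C D E) * (\<eta> C * (\<eta> D * \<eta> E)))"

lemma odd_mult_cubic:
  assumes "\<And>A. gparity False (\<eta> A)"
  shows "\<eta> A * cubic \<eta> B = (if A = B then gconst 6 * fdelta \<eta> else 0)"
proof -
  have "\<eta> A * cubic \<eta> B = (\<Sum>C\<in>UNIV. \<Sum>D\<in>UNIV. \<Sum>E\<in>UNIV.
      gconst (levi_civita B C D E * levi_civita A C D E) * fdelta \<eta>)"
    by (simp add: cubic_def sum_distrib_left gconst_left_commute[of "\<eta> _"] odd_product_4[of \<eta>, OF assms] gconst_mult
        mult.assoc)
  also have "\<dots> = gconst (if A = B then 6 else 0) * fdelta \<eta>"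
    unfolding levi_civita_contract_3[symmetric]
    by (simp add: gconst_sum sum_distrib_right)
  finally show ?thesis
    by simp
qed

text \<open>The product has degree six in four odd elements. One factor of the first cubic turns the
  second into a multiple of \<open>fdelta \<eta>\<close>, and the next factor kills that.\<close>

lemma cubic_mult_cubic:
  assumes "\<And>A. gparity False (\<eta> A)"
  shows "cubic \<eta> A * cubic \<eta> B = 0"
proof -
  have "\<eta> C * (\<eta> D * (\<eta> E * cubic \<eta> B)) = 0" for C D E
    by (simp add: odd_mult_cubic[of \<eta>, OF assms] gconst_left_commute[of "\<eta> _"]
        odd_mult_fdelta[of \<eta>, OF assms])
  then show ?thesis
    by (simp add: cubic_def[of \<eta> A] sum_distrib_right mult.assoc)
qed

section \<open>Homogeneous elements that do not involve given generators\<close>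

definition homogeneous_free :: "'i set \<Rightarrow> bool \<Rightarrow> 'i::finite grassmann \<Rightarrow> bool" where
  "homogeneous_free X p a \<longleftrightarrow> gparity p a \<and> (\<forall>x\<in>X. left_deriv x a = 0)"

text \<open>Vanishing of the derivatives encodes independence of the generators in \<open>X\<close>.
  Parity is carried along because the Leibniz rule for products needs it.\<close>

lemma homogeneous_free_gparity: "homogeneous_free X p a \<Longrightarrow> gparity p a"
  by (simp add: homogeneous_free_def)

lemma homogeneous_free_left_deriv: "homogeneous_free X p a \<Longrightarrow> x \<in> X \<Longrightarrow> left_deriv x a = 0"
  by (simp add: homogeneous_free_def)

lemma homogeneous_free_gconst: "homogeneous_free X True (gconst c)"
  by (simp add: homogeneous_free_def gparity_gconst)

lemma homogeneous_free_gvar: "x \<notin> X \<Longrightarrow> homogeneous_free X False (gvar x)"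
  by (auto simp: homogeneous_free_def gparity_gvar left_deriv_gvar)

lemma homogeneous_free_mult:
  "homogeneous_free X p a \<Longrightarrow> homogeneous_free X q b \<Longrightarrow> r = (p = q) \<Longrightarrow> homogeneous_free X r (a * b)"
  by (auto simp: homogeneous_free_def gparity_mult left_deriv_mult_gparity[where p = p])

lemma homogeneous_free_gconst_mult:
  "homogeneous_free X p a \<Longrightarrow> homogeneous_free X p (gconst c * a)"
  by (auto simp: homogeneous_free_def gparity_gconst_mult left_deriv_gconst_mult)

lemma homogeneous_free_add:
  "homogeneous_free X p a \<Longrightarrow> homogeneous_free X p b \<Longrightarrow> homogeneous_free X p (a + b)"
  by (auto simp: homogeneous_free_def gparity_add left_deriv_add)

lemma homogeneous_free_minus: "homogeneous_free X p a \<Longrightarrow> homogeneous_free X p (- a)"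
  by (auto simp: homogeneous_free_def gparity_minus left_deriv_minus)

lemma homogeneous_free_diff:
  "homogeneous_free X p a \<Longrightarrow> homogeneous_free X p b \<Longrightarrow> homogeneous_free X p (a - b)"
  by (auto simp: homogeneous_free_def gparity_diff left_deriv_diff)

lemma homogeneous_free_0: "homogeneous_free X p (0 :: 'i::finite grassmann)"
proof (cases p)
  case True
  then show ?thesis
    using homogeneous_free_gconst[of X 0] by simp
next
  case False
  \<comment> \<open>\<open>gparity\<close> has no rule for an odd zero, so zero is written as a
    multiple of an arbitrary generator.\<close>
  have "gparity False (gconst 0 * gvar undefined :: 'i grassmann)"
    by (intro gparity_gconst_mult gparity_gvar)
  with False show ?thesis
    by (simp add: homogeneous_free_def)
qed

lemma homogeneous_free_sum:
  "(\<And>i. i \<in> I \<Longrightarrow> homogeneous_free X p (f i)) \<Longrightarrow> homogeneous_free X p (sum f I)"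
  by (induction I rule: infinite_finite_induct)
    (simp_all add: homogeneous_free_0 homogeneous_free_add)

lemma homogeneous_free_fdelta:
  assumes "\<And>A. homogeneous_free X False (\<eta> A)"
  shows "homogeneous_free X True (fdelta \<eta>)"
proof -
  have "homogeneous_free X True (\<eta> 1 * \<eta> 2)"
    using homogeneous_free_mult[OF assms assms] by simp
  then have "homogeneous_free X False (\<eta> 1 * \<eta> 2 * \<eta> 3)"
    using homogeneous_free_mult[OF _ assms] by fastforce
  then show ?thesis
    unfolding fdelta_def using homogeneous_free_mult[OF _ assms] by fastforce
qed

lemma homogeneous_free_cubic:
  assumes "\<And>A. homogeneous_free X False (\<eta> A)"
  shows "homogeneous_free X False (cubic \<eta> B)"
proof -
  have "homogeneous_free X False (\<eta> C * (\<eta> D * \<eta> E))" for C D E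
    using homogeneous_free_mult[OF assms homogeneous_free_mult[OF assms assms refl] refl] by simp
  then show ?thesis
    unfolding cubic_def by (intro homogeneous_free_sum homogeneous_free_gconst_mult)
qed

section \<open>Linearity, commutation and translation of Berezin integrals\<close>

lemma berezin_append: "berezin (xs @ ys) a = berezin ys (berezin xs a)"
  by (simp add: berezin_def)

lemma berezin_sum: "berezin xs (sum f I) = (\<Sum>i\<in>I. berezin xs (f i))"
  by (induction I rule: infinite_finite_induct) (simp_all add: berezin_add)

lemma berezin_minus: "berezin xs (- a) = - berezin xs a"
  using berezin_gconst_mult[of xs "- 1" a] by (simp add: gconst_minus)

lemma berezin_diff: "berezin xs (a - b) = berezin xs a - berezin xs b"
  using berezin_add[of xs a "- b"] by (simp add: berezin_minus)

text \<open>The integral is an iterated derivative, and moving \<open>x\<close> past each of its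
  derivatives costs one sign.\<close>

lemma left_deriv_berezin:
  "left_deriv x (berezin xs a) = (if even (length xs) then berezin xs (left_deriv x a)
    else - berezin xs (left_deriv x a))"
proof (induction xs arbitrary: a)
  case (Cons y xs)
  then show ?case
    by (simp add: berezin_Cons left_deriv_anticommute[of x y] berezin_minus)
qed simp

lemma berezin_commute:
  "even (length xs) \<Longrightarrow> berezin ys (berezin xs a) = berezin xs (berezin ys a)"
proof (induction ys arbitrary: a)
  case (Cons y ys)
  then show ?case
    by (simp only: berezin_Cons left_deriv_berezin if_True)
qed simp

lemma berezin_homogeneous_mult:
  assumes "homogeneous_free (set xs) p b"
  shows "berezin xs (b * a) = (if p \<or> even (length xs) then b * berezin xs a else - (b * berezin xs a))"
  using assms
proof (induction xs arbitrary: a)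
  case (Cons x xs)
  then have "homogeneous_free (set xs) p b" "left_deriv x b = 0" "gparity p b"
    by (auto simp: homogeneous_free_def)
  then show ?case
    using Cons.IH by (simp add: berezin_Cons left_deriv_mult_gparity[where p = p] berezin_minus)
qed simp

text \<open>Translation invariance: each derivative in turn removes its own factor, since neither
  the shifts, nor the other factors, nor \<open>f\<close> involve its generator.\<close>

lemma berezin_shifted_delta:
  fixes \<eta> :: "4 \<Rightarrow> 'i::finite grassmann"
  assumes "distinct [x1, x2, x3, x4]"
    and \<eta>: "\<And>A. homogeneous_free {x1, x2, x3, x4} False (\<eta> A)"
    and f: "\<And>x. x \<in> {x1, x2, x3, x4} \<Longrightarrow> left_deriv x f = 0"
  shows "berezin [x1, x2, x3, x4]
    ((gvar x1 - \<eta> 1) * (gvar x2 - \<eta> 2) * (gvar x3 - \<eta> 3) * (gvar x4 - \<eta> 4) * f) = f"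
proof -
  have "left_deriv x ((gvar y - \<eta> B) * a) = (if x = y then a else 0)"
    if "left_deriv x a = 0" "x \<in> {x1, x2, x3, x4}" for x y B a
    using that homogeneous_free_gparity[OF \<eta>[of B]] homogeneous_free_left_deriv[OF \<eta>[of B] that(2)]
    by (simp add: left_deriv_mult_gparity[of False] gparity_diff gparity_gvar left_deriv_diff
        left_deriv_gvar)
  then show ?thesis
    using assms(1) f by (simp add: berezin_Cons mult.assoc)
qed


section \<open>Points of the deformed curve and integrals over them\<close>

definition dual_cube :: "complex ^ 4 ^ 4 \<Rightarrow> 4 \<Rightarrow> gen grassmann" where
  "dual_cube M A = gconst (1 / 6) * (\<Sum>B\<in>UNIV. gconst (M $ A $ B) * cubic \<theta>\<^sub>2 B)"

text \<open>\<open>dual_cube M A\<close> and \<open>curve_point M Z i A\<close> are the elements m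
  and P of the outline. Constants stand on the left, where derivatives and integrals pull them out
  directly.\<close>

definition curve_point :: "complex ^ 4 ^ 4 \<Rightarrow> complex ^ 4 \<Rightarrow> 4 \<Rightarrow> 4 \<Rightarrow> gen grassmann" where
  "curve_point M Z i A = - \<theta>\<^sub>1 A - gconst (Z $ i) * \<theta>\<^sub>2 A + gconst ((Z $ i)\<^sup>2) * dual_cube M A"

lemma curve_arg_eq: "curve_arg M Z i A = \<Psi> i A - curve_point M Z i A"
proof -
  have "(\<Sum>B\<in>UNIV. \<Sum>C\<in>UNIV. \<Sum>D\<in>UNIV. \<Sum>E\<in>UNIV.
      gconst (M $ A $ B * levi_civita B C D E) * \<theta>\<^sub>2 C * \<theta>\<^sub>2 D * \<theta>\<^sub>2 E)
      = (\<Sum>B\<in>UNIV. gconst (M $ A $ B) * cubic \<theta>\<^sub>2 B)"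
    by (simp add: cubic_def sum_distrib_left gconst_mult mult.assoc)
  then show ?thesis
    by (simp add: curve_arg_def curve_point_def dual_cube_def gconst_commute[of "\<theta>\<^sub>2 A"]
        gconst_commute[of "gconst (1 / 6) * _"])
qed

lemma homogeneous_free_dual_cube:
  "X \<inter> range Th2 = {} \<Longrightarrow> homogeneous_free X False (dual_cube M A)"
  unfolding dual_cube_def
  by (intro homogeneous_free_gconst_mult homogeneous_free_sum homogeneous_free_cubic
      homogeneous_free_gvar) auto

lemma homogeneous_free_curve_point:
  "X \<inter> range Th1 = {} \<Longrightarrow> X \<inter> range Th2 = {} \<Longrightarrow> homogeneous_free X False (curve_point M Z i A)"
  unfolding curve_point_def
  by (intro homogeneous_free_diff homogeneous_free_add homogeneous_free_minus
      homogeneous_free_gconst_mult homogeneous_free_dual_cube homogeneous_free_gvar) auto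

text \<open>The sum over the second index of \<open>M\<close> collapses to the label of
  \<open>\<theta>\<^sub>2\<close>, and the 6 from \<open>odd_mult_cubic\<close> cancels the
  1/6.\<close>

lemma \<theta>\<^sub>2_mult_dual_cube: "\<theta>\<^sub>2 A * dual_cube M B = gconst (M $ B $ A) * fdelta \<theta>\<^sub>2"
proof -
  have "\<theta>\<^sub>2 A * dual_cube M B =
      gconst (1 / 6) * (\<Sum>C\<in>UNIV. gconst (M $ B $ C) * (if A = C then gconst 6 * fdelta \<theta>\<^sub>2 else 0))"
    by (simp only: dual_cube_def gconst_left_commute[of "\<theta>\<^sub>2 _"] sum_distrib_left
        odd_mult_cubic[of \<theta>\<^sub>2, OF gparity_gvar])
  also have "\<dots> = gconst (1 / 6) * (gconst (M $ B $ A) * (gconst 6 * fdelta \<theta>\<^sub>2))"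
    by (simp add: if_distrib[of "(*) _"] cong: if_cong)
  also have "\<dots> = gconst (1 / 6 * (M $ B $ A) * 6) * fdelta \<theta>\<^sub>2"
    by (simp only: gconst_mult mult.assoc)
  finally show ?thesis by simp
qed

lemma dual_cube_mult_\<theta>\<^sub>2: "dual_cube M B * \<theta>\<^sub>2 A = - (gconst (M $ B $ A) * fdelta \<theta>\<^sub>2)"
  using odd_anticommute[OF homogeneous_free_gparity[OF homogeneous_free_dual_cube[of "{}"]] gparity_gvar]
    \<theta>\<^sub>2_mult_dual_cube by simp

lemma dual_cube_mult_dual_cube: "dual_cube M A * dual_cube M B = 0"
proof -
  have *: "cubic \<theta>\<^sub>2 C * dual_cube M B = 0" for C
    by (simp add: dual_cube_def gconst_left_commute[of "cubic \<theta>\<^sub>2 _"] sum_distrib_left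
        cubic_mult_cubic[of \<theta>\<^sub>2, OF gparity_gvar])
  show ?thesis
    by (simp add: dual_cube_def[of M A] sum_distrib_right mult.assoc *)
qed

text \<open>A degree count: the product of two generators has degree two and integrates to zero, and
  the product of two cubics vanishes. The two mixed terms remain, with opposite signs because their
  odd factors stand in opposite order.\<close>

lemma berezin_\<theta>\<^sub>2_product:
  "berezin [Th2 1, Th2 2, Th2 3, Th2 4]
    ((gconst a * \<theta>\<^sub>2 A + gconst b * dual_cube M A) * (gconst c * \<theta>\<^sub>2 B + gconst d * dual_cube M B))
    = gconst (a * d * M $ B $ A - b * c * M $ A $ B)"
proof -
  let ?I = "berezin [Th2 1, Th2 2, Th2 3, Th2 4]"
  have lin: "?I (\<theta>\<^sub>2 A * \<theta>\<^sub>2 B) = 0"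
    by (simp add: berezin_Cons left_deriv_gvar_mult left_deriv_gvar left_deriv_diff)
  have vol: "?I (fdelta \<theta>\<^sub>2) = 1"
    using berezin_monomial[of "[Th2 1, Th2 2, Th2 3, Th2 4]" 1]
    by (simp add: fdelta_def mult.assoc)
  have "(gconst a * \<theta>\<^sub>2 A + gconst b * dual_cube M A) * (gconst c * \<theta>\<^sub>2 B + gconst d * dual_cube M B)
      = gconst a * (gconst c * (\<theta>\<^sub>2 A * \<theta>\<^sub>2 B)) + gconst a * (gconst d * (\<theta>\<^sub>2 A * dual_cube M B))
      + gconst b * (gconst c * (dual_cube M A * \<theta>\<^sub>2 B))
      + gconst b * (gconst d * (dual_cube M A * dual_cube M B))"
    by (simp add: distrib_left distrib_right mult.assoc gconst_left_commute[of "\<theta>\<^sub>2 _"]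
        gconst_left_commute[of "dual_cube _ _"])
  then show ?thesis
    by (simp add: berezin_add berezin_gconst_mult lin \<theta>\<^sub>2_mult_dual_cube dual_cube_mult_\<theta>\<^sub>2
        dual_cube_mult_dual_cube berezin_diff vol gconst_diff gconst_mult mult.assoc)
qed

lemma fdelta_minus: "fdelta (\<lambda>A. - \<eta> A) = fdelta \<eta>"
  by (simp add: fdelta_def)

lemma berezin_\<theta>\<^sub>1_fdelta_curve_point:
  assumes "\<And>A. left_deriv (Th1 A) f = 0"
  shows "berezin [Th1 1, Th1 2, Th1 3, Th1 4] (fdelta (curve_point M Z i) * f) = f"
proof -
  let ?\<eta> = "\<lambda>A. - (gconst (Z $ i) * \<theta>\<^sub>2 A) + gconst ((Z $ i)\<^sup>2) * dual_cube M A"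
  have "homogeneous_free {Th1 1, Th1 2, Th1 3, Th1 4} False (?\<eta> A)" for A
    by (intro homogeneous_free_diff homogeneous_free_add homogeneous_free_minus
      homogeneous_free_gconst_mult homogeneous_free_dual_cube homogeneous_free_gvar) auto
  moreover have "fdelta (curve_point M Z i) = fdelta (\<lambda>A. \<theta>\<^sub>1 A - ?\<eta> A)"
    \<comment> \<open>The four sign changes cancel, which turns the leading
      \<open>- \<theta>\<^sub>1 A\<close> into the positive generator required by
      \<open>berezin_shifted_delta\<close>.\<close>
    by (subst fdelta_minus[symmetric]) (simp add: curve_point_def algebra_simps)
  ultimately show ?thesis
    using berezin_shifted_delta[of "Th1 1" "Th1 2" "Th1 3" "Th1 4" ?\<eta> f] assms
    by (auto simp: fdelta_def)
qed

section \<open>Normal forms of the wavefunctions\<close>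

definition pairing :: "(4 \<Rightarrow> gen grassmann) \<Rightarrow> complex ^ 4 \<Rightarrow> gen grassmann" where
  "pairing \<eta> c = (\<Sum>A\<in>UNIV. gconst (c $ A) * \<eta> A)"

lemma homogeneous_free_pairing:
  "(\<And>A. homogeneous_free X False (\<eta> A)) \<Longrightarrow> homogeneous_free X False (pairing \<eta> c)"
  unfolding pairing_def by (intro homogeneous_free_sum homogeneous_free_gconst_mult)

lemma pairing_mult_fdelta:
  assumes "\<And>A. gparity False (\<eta> A)"
  shows "pairing \<eta> c * fdelta \<eta> = 0" "fdelta \<eta> * pairing \<eta> c = 0"
  by (simp_all add: pairing_def sum_distrib_left sum_distrib_right mult.assoc
      odd_mult_fdelta[of \<eta>, OF assms] gconst_left_commute[of "fdelta \<eta>"])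

lemma pairing_add: "pairing (\<lambda>A. \<eta> A + \<zeta> A) c = pairing \<eta> c + pairing \<zeta> c"
  by (simp add: pairing_def distrib_left sum.distrib)

lemma wf_plus_half_eq: "wf_plus_half i c = pairing (\<Psi> i) c"
  by (simp add: wf_plus_half_def pairing_def gconst_commute)

text \<open>Each of the 4! orderings of distinct labels contributes a squared sign times the same
  product, so their number cancels the 1/24.\<close>

lemma wf_minus_one_eq: "wf_minus_one i G = gconst G * fdelta (\<Psi> i)"
proof -
  have "(\<Sum>A\<in>UNIV. \<Sum>B\<in>UNIV. \<Sum>C\<in>UNIV. \<Sum>D\<in>UNIV.
      gconst (levi_civita A B C D) * \<Psi> i A * \<Psi> i B * \<Psi> i C * \<Psi> i D)
      = gconst (\<Sum>A\<in>UNIV. \<Sum>B\<in>UNIV. \<Sum>C\<in>UNIV. \<Sum>D\<in>UNIV.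
          levi_civita A B C D * levi_civita A B C D) * fdelta (\<Psi> i)"
    by (simp add: mult.assoc odd_product_4[of "\<Psi> i", OF gparity_gvar] gconst_sum gconst_mult
        sum_distrib_right)
  also have "\<dots> = gconst 24 * fdelta (\<Psi> i)"
    by (simp add: levi_civita_contract_3)
  finally have "wf_minus_one i G = gconst (1 / 24) * (gconst 24 * fdelta (\<Psi> i)) * gconst G"
    by (simp add: wf_minus_one_def)
  also have "\<dots> = gconst (1 / 24 * 24) * (fdelta (\<Psi> i) * gconst G)"
    by (simp only: gconst_mult mult.assoc)
  finally show ?thesis
    by (simp add: gconst_commute)
qed

lemma int_\<Psi>_homogeneous_mult:
  "homogeneous_free (range (Ps i)) p b \<Longrightarrow> int_\<Psi> i (b * a) = b * int_\<Psi> i a"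
  using berezin_homogeneous_mult[of "[Ps i 1, Ps i 2, Ps i 3, Ps i 4]" p b a]
  by (simp add: int_\<Psi>_def homogeneous_free_def)

text \<open>This brings the integral over the moduli to the outside, so that the substitution for
  \<open>\<Psi>\<close> can be carried out first.\<close>

lemma int_\<theta>_\<Psi>_commute: "int_\<Psi> i (int_\<theta> a) = int_\<theta> (int_\<Psi> i a)"
  unfolding int_\<Psi>_def int_\<theta>_def by (rule berezin_commute) simp

section \<open>The \<Psi> integrals as substitutions\<close>

context
  fixes M :: "complex ^ 4 ^ 4" and Z :: "complex ^ 4"
begin

private abbreviation (input) \<delta> :: "4 \<Rightarrow> gen grassmann" where "\<delta> i \<equiv> fdelta (curve_arg M Z i)"
private abbreviation (input) P :: "4 \<Rightarrow> 4 \<Rightarrow> gen grassmann" where "P \<equiv> curve_point M Z"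

private lemma curve_arg_fun: "curve_arg M Z i = (\<lambda>A. \<Psi> i A - P i A)"
  by (simp add: curve_arg_eq fun_eq_iff)

private lemma free_P: "homogeneous_free (range (Ps i)) False (P j A)"
  by (rule homogeneous_free_curve_point) auto

private lemma odd_P: "gparity False (P j A)"
  using free_P by (rule homogeneous_free_gparity)

private lemma deriv_P: "left_deriv (Ps i B) (P j A) = 0"
  by (rule homogeneous_free_left_deriv[OF free_P[of i]]) simp

private lemma free_\<Psi>: "i \<noteq> j \<Longrightarrow> homogeneous_free (range (Ps i)) False (\<Psi> j A)"
  by (rule homogeneous_free_gvar) auto

lemma free_\<delta>: "i \<noteq> j \<Longrightarrow> homogeneous_free (range (Ps i)) True (\<delta> j)"
  unfolding curve_arg_fun by (intro homogeneous_free_fdelta homogeneous_free_diff free_\<Psi> free_P)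

lemma int_\<Psi>_\<delta>_left:
  assumes "homogeneous_free (range (Ps i)) p b"
  shows "int_\<Psi> i (\<delta> i * (b * a)) = b * int_\<Psi> i (\<delta> i * a)"
proof -
  \<comment> \<open>Only evenness of \<open>\<delta> i\<close> is wanted here. It does involve the
    \<open>\<Psi> i A\<close>, hence the empty set of excluded generators.\<close>
  have "homogeneous_free {} True (\<delta> i)"
    unfolding curve_arg_fun
    by (intro homogeneous_free_fdelta homogeneous_free_diff homogeneous_free_gvar
        homogeneous_free_curve_point) auto
  then have "\<delta> i * b = b * \<delta> i"
    using gparity_commute[of True "\<delta> i" p b, OF homogeneous_free_gparity homogeneous_free_gparity, OF _ assms]
    by (simp only: simp_thms if_True)
  then have "\<delta> i * (b * a) = b * (\<delta> i * a)"
    by (metis mult.assoc)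
  then show ?thesis
    by (simp add: int_\<Psi>_homogeneous_mult[OF assms])
qed

lemma int_\<Psi>_\<delta>_\<Psi>: "int_\<Psi> i (\<delta> i * (\<Psi> i A * a)) = P i A * int_\<Psi> i (\<delta> i * a)"
  unfolding curve_arg_fun by (rule int_\<Psi>_delta_mult) (simp_all add: odd_P deriv_P)

lemma int_\<Psi>_\<delta>_const:
  "(\<And>A. left_deriv (Ps i A) a = 0) \<Longrightarrow> int_\<Psi> i (\<delta> i * a) = a"
  unfolding curve_arg_fun by (rule int_\<Psi>_delta_const) (simp_all add: odd_P deriv_P)

lemma int_\<Psi>_\<delta>_fdelta: "int_\<Psi> i (\<delta> i * (fdelta (\<Psi> i) * a)) = fdelta (P i) * int_\<Psi> i (\<delta> i * a)"
  by (simp add: fdelta_def[of "\<Psi> i"] fdelta_def[of "P i"] mult.assoc int_\<Psi>_\<delta>_\<Psi>)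

lemma int_\<Psi>_\<delta>_pairing:
  "int_\<Psi> i (\<delta> i * (pairing (\<Psi> i) c * a)) = pairing (P i) c * int_\<Psi> i (\<delta> i * a)"
proof -
  have "int_\<Psi> i (\<delta> i * (pairing (\<Psi> i) c * a)) = (\<Sum>A\<in>UNIV. gconst (c $ A) * int_\<Psi> i (\<delta> i * (\<Psi> i A * a)))"
    by (simp add: pairing_def sum_distrib_left sum_distrib_right mult.assoc int_\<Psi>_def berezin_sum
        gconst_left_commute[of "\<delta> i"] berezin_gconst_mult)
  then show ?thesis
    by (simp add: int_\<Psi>_\<delta>_\<Psi> pairing_def sum_distrib_right mult.assoc)
qed

text \<open>The integrals are done from the inside out. At each stage the factors free of the
  current \<open>\<Psi>\<close> move to the left, and the delta function substitutes into the rest.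
  The integral for particle 2, whose wavefunction is a scalar, merely removes its delta
  function.\<close>

lemma int_\<Psi>_wavefunctions:
  "int_\<Psi> 1 (int_\<Psi> 2 (int_\<Psi> 3 (int_\<Psi> 4
      (\<delta> 1 * (\<delta> 2 * (\<delta> 3 * (\<delta> 4 * (pairing (\<Psi> 1) c * (fdelta (\<Psi> 3) * pairing (\<Psi> 4) d)))))))))
    = pairing (P 1) c * (fdelta (P 3) * pairing (P 4) d)"
proof -
  note free = homogeneous_free_pairing[OF free_\<Psi>] homogeneous_free_fdelta[OF free_\<Psi>]
    homogeneous_free_pairing[OF free_P] homogeneous_free_fdelta[OF free_P]
  have deriv: "left_deriv (Ps i A) (pairing (P j) d) = 0" for i j A d
    by (rule homogeneous_free_left_deriv[OF free(3)[of i]]) simp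
  have deriv_rest: "left_deriv (Ps 2 A) (pairing (\<Psi> 1) c * (fdelta (P 3) * pairing (P 4) d)) = 0" for A
    by (rule homogeneous_free_left_deriv[OF homogeneous_free_mult[OF free(1)
            homogeneous_free_mult[OF free(4) free(3) refl] refl], of 2]) auto
  \<comment> \<open>The pairing stands last in the product, so the trailing factor of the general
    rules is taken to be 1.\<close>
  have I4: "int_\<Psi> 4 (\<delta> 4 * pairing (\<Psi> 4) d) = pairing (P 4) d"
    using int_\<Psi>_\<delta>_pairing[of 4 d 1] int_\<Psi>_\<delta>_const[of 4 1] by simp
  have "int_\<Psi> 4 (\<delta> 1 * (\<delta> 2 * (\<delta> 3 * (\<delta> 4 * (pairing (\<Psi> 1) c * (fdelta (\<Psi> 3) * pairing (\<Psi> 4) d))))))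
      = \<delta> 1 * (\<delta> 2 * (\<delta> 3 * (pairing (\<Psi> 1) c * (fdelta (\<Psi> 3) * pairing (P 4) d))))"
    by (simp add: int_\<Psi>_homogeneous_mult[OF free_\<delta>] int_\<Psi>_\<delta>_left[OF free(1)]
        int_\<Psi>_\<delta>_left[OF free(2)] I4)
  moreover have "int_\<Psi> 3 (\<delta> 1 * (\<delta> 2 * (\<delta> 3 * (pairing (\<Psi> 1) c * (fdelta (\<Psi> 3) * pairing (P 4) d)))))
      = \<delta> 1 * (\<delta> 2 * (pairing (\<Psi> 1) c * (fdelta (P 3) * pairing (P 4) d)))"
    by (simp add: int_\<Psi>_homogeneous_mult[OF free_\<delta>] int_\<Psi>_\<delta>_left[OF free(1)]
        int_\<Psi>_\<delta>_fdelta int_\<Psi>_\<delta>_const deriv)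
  moreover have "int_\<Psi> 2 (\<delta> 1 * (\<delta> 2 * (pairing (\<Psi> 1) c * (fdelta (P 3) * pairing (P 4) d))))
      = \<delta> 1 * (pairing (\<Psi> 1) c * (fdelta (P 3) * pairing (P 4) d))"
    by (simp add: int_\<Psi>_homogeneous_mult[OF free_\<delta>] int_\<Psi>_\<delta>_const deriv_rest)
  moreover have "int_\<Psi> 1 (\<delta> 1 * (pairing (\<Psi> 1) c * (fdelta (P 3) * pairing (P 4) d)))
      = pairing (P 1) c * (fdelta (P 3) * pairing (P 4) d)"
    by (simp add: int_\<Psi>_\<delta>_pairing int_\<Psi>_\<delta>_left[OF free(4)] int_\<Psi>_\<delta>_const
        deriv)
  ultimately show ?thesis by simp
qed

section \<open>The integral over the moduli\<close>

lemma int_\<theta>_product: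
  "int_\<theta> (pairing (P i) c * (fdelta (P k) * pairing (P j) d)) =
    gconst (\<Sum>A\<in>UNIV. \<Sum>B\<in>UNIV. c $ A * d $ B *
      ((Z $ k - Z $ i) * ((Z $ j)\<^sup>2 - (Z $ k)\<^sup>2) * M $ B $ A -
       ((Z $ i)\<^sup>2 - (Z $ k)\<^sup>2) * (Z $ k - Z $ j) * M $ A $ B))"
proof -
  \<comment> \<open>This is the difference of \<open>P i A\<close> and \<open>P k A\<close>; the
    \<open>\<theta>\<^sub>1\<close> terms cancel in it.\<close>
  define R where "R i A = gconst (Z $ k - Z $ i) * \<theta>\<^sub>2 A + gconst ((Z $ i)\<^sup>2 - (Z $ k)\<^sup>2) * dual_cube M A" for i A
  have "P i = (\<lambda>A. P k A + R i A)" for i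
    by (simp add: fun_eq_iff curve_point_def R_def gconst_diff algebra_simps)
  then have pair: "pairing (P i) c = pairing (P k) c + pairing (R i) c" for i c
    by (metis pairing_add)
  have free_R: "homogeneous_free (range Th1) False (R i A)" for i A
    unfolding R_def by (intro homogeneous_free_add homogeneous_free_gconst_mult homogeneous_free_gvar
        homogeneous_free_dual_cube) auto
  then have free: "homogeneous_free (range Th1) False (pairing (R i) c)" for i c
    by (rule homogeneous_free_pairing)
  have even: "gparity True (fdelta (P k))"
    using homogeneous_free_fdelta[OF free_P] by (rule homogeneous_free_gparity)
  have comm: "pairing (R i) c * fdelta (P k) = fdelta (P k) * pairing (R i) c" for i c
    using gparity_commute[OF homogeneous_free_gparity[OF free] even] by simp
  \<comment> \<open>The delta function annihilates the \<open>P k\<close> part of the pairing on its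
    right, and then of the one on its left. Being even, it then moves to the front.\<close>
  have "pairing (P i) c * (fdelta (P k) * pairing (P j) d)
      = (pairing (P i) c * fdelta (P k)) * pairing (R j) d"
    by (simp add: pair[of j] distrib_left pairing_mult_fdelta[of "P k", OF odd_P] mult.assoc)
  also have "pairing (P i) c * fdelta (P k) = fdelta (P k) * pairing (R i) c"
    by (simp add: pair[of i] distrib_right pairing_mult_fdelta[of "P k", OF odd_P] comm)
  \<comment> \<open>\<open>berezin\<close> takes its generators from the head of the list, so the
    integral over \<open>\<theta>\<^sub>1\<close> is the inner one and uses up the delta
    function.\<close>
  finally have "int_\<theta> (pairing (P i) c * (fdelta (P k) * pairing (P j) d)) =
      berezin [Th2 1, Th2 2, Th2 3, Th2 4] (berezin [Th1 1, Th1 2, Th1 3, Th1 4]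
        (fdelta (P k) * (pairing (R i) c * pairing (R j) d)))"
    by (simp add: int_\<theta>_def mult.assoc flip: berezin_append)
  also have "\<dots> = berezin [Th2 1, Th2 2, Th2 3, Th2 4] (pairing (R i) c * pairing (R j) d)"
    by (subst berezin_\<theta>\<^sub>1_fdelta_curve_point)
      (simp_all add: homogeneous_free_left_deriv[OF homogeneous_free_mult[OF free free refl]])
  also have "pairing (R i) c * pairing (R j) d =
      (\<Sum>A\<in>UNIV. \<Sum>B\<in>UNIV. gconst (c $ A * d $ B) * (R i A * R j B))"
    by (simp add: pairing_def sum_product mult.assoc gconst_mult gconst_left_commute[of "R _ _"])
  also have "berezin [Th2 1, Th2 2, Th2 3, Th2 4] \<dots> =
      (\<Sum>A\<in>UNIV. \<Sum>B\<in>UNIV. gconst (c $ A * d $ B) *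
        berezin [Th2 1, Th2 2, Th2 3, Th2 4] (R i A * R j B))"
    by (simp only: berezin_sum berezin_gconst_mult)
  finally show ?thesis
    by (simp only: R_def berezin_\<theta>\<^sub>2_product gconst_sum gconst_mult)
qed

end

section \<open>Assembly of the amplitude\<close>

theorem mainTheorem2:
  fixes M :: "complex ^ 4 ^ 4" and Z chi1 chi4 :: "complex ^ 4" and g A\<^sub>2 G\<^sub>3 :: complex
  assumes "\<forall>A B. M $ A $ B = M $ B $ A"
    and "\<forall>i j. i \<noteq> j \<longrightarrow> Z $ i \<noteq> Z $ j"
  shows "gconst (2 * \<i> * g\<^sup>2) *
      int_\<Psi> 1 (int_\<Psi> 2 (int_\<Psi> 3 (int_\<Psi> 4 (int_\<theta>
        (fdelta (curve_arg M Z 1) * fdelta (curve_arg M Z 2) *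
         fdelta (curve_arg M Z 3) * fdelta (curve_arg M Z 4) *
         (wf_plus_half 1 chi1 * wf_plus_one A\<^sub>2 * wf_minus_one 3 G\<^sub>3 * wf_plus_half 4 chi4) *
         gconst (1 / (\<Prod>i\<in>UNIV. bracket Z i (i + 1))))))))
    = gconst (2 * \<i> * g\<^sup>2 *
        (bracket Z 3 1 * bracket Z 3 4 * bracket Z 4 1 / (\<Prod>i\<in>UNIV. bracket Z i (i + 1))) *
        (\<Sum>B\<in>UNIV. \<Sum>A\<in>UNIV. chi4 $ B * M $ B $ A * chi1 $ A) * G\<^sub>3 * A\<^sub>2)"
proof -
  define w where "w = 1 / (\<Prod>i\<in>UNIV. bracket Z i (i + 1))"
  define S where "S = (\<Sum>B\<in>UNIV. \<Sum>A\<in>UNIV. chi4 $ B * M $ B $ A * chi1 $ A)"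
  define \<delta> where "\<delta> i = fdelta (curve_arg M Z i)" for i
  have wavefunctions: "wf_plus_half 1 chi1 * wf_plus_one A\<^sub>2 * wf_minus_one 3 G\<^sub>3 * wf_plus_half 4 chi4
      = gconst (A\<^sub>2 * G\<^sub>3) * (pairing (\<Psi> 1) chi1 * (fdelta (\<Psi> 3) * pairing (\<Psi> 4) chi4))"
    by (simp add: wf_plus_half_eq wf_plus_one_def wf_minus_one_eq gconst_mult mult.assoc
        gconst_left_commute[of "pairing _ _"])
  \<comment> \<open>All scalars, including the inverse product of brackets, are collected in front,
    where every integral is linear.\<close>
  have "\<delta> 1 * \<delta> 2 * \<delta> 3 * \<delta> 4 * (gconst (A\<^sub>2 * G\<^sub>3) * x) * gconst w
      = gconst (w * A\<^sub>2 * G\<^sub>3) * (\<delta> 1 * (\<delta> 2 * (\<delta> 3 * (\<delta> 4 * x))))" for x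
    by (simp add: gconst_commute[of _ w] gconst_mult mult.assoc gconst_left_commute[of "\<delta> _"])
  then have "int_\<Psi> 1 (int_\<Psi> 2 (int_\<Psi> 3 (int_\<Psi> 4 (int_\<theta>
        (\<delta> 1 * \<delta> 2 * \<delta> 3 * \<delta> 4 *
         (wf_plus_half 1 chi1 * wf_plus_one A\<^sub>2 * wf_minus_one 3 G\<^sub>3 * wf_plus_half 4 chi4) * gconst w)))))
      = gconst (w * A\<^sub>2 * G\<^sub>3) * int_\<theta> (int_\<Psi> 1 (int_\<Psi> 2 (int_\<Psi> 3 (int_\<Psi> 4
          (\<delta> 1 * (\<delta> 2 * (\<delta> 3 * (\<delta> 4 *
            (pairing (\<Psi> 1) chi1 * (fdelta (\<Psi> 3) * pairing (\<Psi> 4) chi4))))))))))"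
    unfolding wavefunctions int_\<theta>_\<Psi>_commute by (simp add: int_\<Psi>_def int_\<theta>_def berezin_gconst_mult)
  also have "\<dots> = gconst (w * A\<^sub>2 * G\<^sub>3) * gconst (\<Sum>A\<in>UNIV. \<Sum>B\<in>UNIV. chi1 $ A * chi4 $ B *
      ((Z $ 3 - Z $ 1) * ((Z $ 4)\<^sup>2 - (Z $ 3)\<^sup>2) * M $ B $ A -
       ((Z $ 1)\<^sup>2 - (Z $ 3)\<^sup>2) * (Z $ 3 - Z $ 4) * M $ A $ B))"
    unfolding \<delta>_def int_\<Psi>_wavefunctions int_\<theta>_product ..
  also have "(\<Sum>A\<in>UNIV. \<Sum>B\<in>UNIV. chi1 $ A * chi4 $ B *
      ((Z $ 3 - Z $ 1) * ((Z $ 4)\<^sup>2 - (Z $ 3)\<^sup>2) * M $ B $ A -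
       ((Z $ 1)\<^sup>2 - (Z $ 3)\<^sup>2) * (Z $ 3 - Z $ 4) * M $ A $ B))
      = (\<Sum>A\<in>UNIV. \<Sum>B\<in>UNIV. (bracket Z 3 1 * bracket Z 3 4 * bracket Z 4 1) *
          (chi4 $ B * M $ B $ A * chi1 $ A))"
  proof (intro sum.cong refl)
    fix A B :: 4
    \<comment> \<open>By symmetry both terms carry the same entry of \<open>M\<close>. Taking out
      (Z1 - Z3)(Z4 - Z3) leaves (Z1 + Z3) - (Z4 + Z3) = Z1 - Z4, so the three factors are the
      brackets of the claim.\<close>
    have "M $ A $ B = M $ B $ A" using assms(1) by blast
    then show "chi1 $ A * chi4 $ B *
      ((Z $ 3 - Z $ 1) * ((Z $ 4)\<^sup>2 - (Z $ 3)\<^sup>2) * M $ B $ A -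
       ((Z $ 1)\<^sup>2 - (Z $ 3)\<^sup>2) * (Z $ 3 - Z $ 4) * M $ A $ B) =
      (bracket Z 3 1 * bracket Z 3 4 * bracket Z 4 1) * (chi4 $ B * M $ B $ A * chi1 $ A)"
      unfolding bracket_def by (simp add: power2_eq_square algebra_simps)
  qed
  also have "\<dots> = bracket Z 3 1 * bracket Z 3 4 * bracket Z 4 1 * S"
    unfolding S_def by (subst sum.swap) (simp add: sum_distrib_left)
  finally show ?thesis
    unfolding \<delta>_def w_def S_def[symmetric] by (simp add: ac_simps flip: gconst_mult)
qed

end
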